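(* Let $G$ be a second-countable locally compact amenable unimodular group with an irreducible, square-integrable projective unitary representation $(\pi, \mathcal{H}_{\pi})$ of formal degree $d_{\pi} > 0$. Let $\Lambda \subseteq G$ be locally finite and $g \in \mathcal{H}_{\pi}$. (i) If $\pi(\Lambda) g$ is uniformly minimal, then $D^+(\Lambda) \leq d_{\pi}$. (ii) If, for some $k\in\mathbb{N}$, $\Lambda \subseteq G$ is a uniform $k$-approximate lattice and $\pi(\Lambda^2) g$ is minimal, then $D^+(\Lambda^2) \leq d_{\pi} k$.
   Context: Fix a Haar measure $\mu$ on $G$. Point sets. $\Lambda \subseteq G$ is locally finite if it is closed and discrete (equivalently, $\Lambda\cap K$ is finite for all compact $K$); relatively dense if there is a compact $K \subseteq G$ with $\Lambda K = G$; uniformly discrete if there is a non-empty open set $V \subseteq G$ with $|\Lambda \cap xV| \leq 1$ for all $x \in G$; Delone if it is relatively dense and uniformly discrete. Write $\Lambda^2 = \{\lambda\lambda' : \lambda,\lambda' \in \Lambda\}$. $\Lambda$ is a $k$-approximate subgroup if (a1) $e \in \Lambda$; (a2) $\Lambda^{-1} = \Lambda$; (a3) there is a finite set $F \subseteq G$ with $|F| \leq k$ and $\Lambda^2 \subseteq F\Lambda$. A uniform $k$-approximate lattice is a $k$-approximate subgroup that is also a Delone set. Beurling density. A (right) strong Følner sequence in $G$ is a sequence $(K_n)_{n\in\mathbb{N}}$ of non-null compact sets such that for all compact $K \subseteq G$ one has $\mu(K_n \triangle K_nK)/\mu(K_n) \to 0$ and $\mu(K_nK \cap K_n^cK)/\mu(K_n)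 \to 0$ as $n \to \infty$, where $K_n^c = G \setminus K_n$. Such a sequence exists in every second-countable amenable group. The upper Beurling density is $D^+(\Lambda) = \limsup_{n\to\infty} \sup_{x\in G} |\Lambda \cap xK_n|/\mu(K_n)$; it does not depend on the choice of strong Følner sequence. Representations. A projective unitary representation of $G$ is a strongly continuous map $\pi: G \to \mathcal{U}(\mathcal{H}_\pi)$ into the unitary operators on a Hilbert space with $\pi(x)\pi(y) = \sigma(x,y)\pi(xy)$ for all $x,y\in G$, for some (2-cocycle) $\sigma: G\times G \to \mathbb{T}$. It is irreducible if $\{0\}$ and $\mathcal{H}_\pi$ are the only closed $\pi(G)$-invariant subspaces. An irreducible $\pi$ is square-integrable (a discrete series) if there is a non-zero $g \in \mathcal{H}_\pi$ with $\int_G |\langle g,\pi(x)g\rangle|^2\,d\mu(x) < \infty$; then its formal degree is the number $d_\pi > 0$ such that $\int_G |\langle f,\pi(x)g\rangle|^2\,d\mu(x) = d_\pi^{-1}\|f\|^2\|g\|^2$ for all $f,g\in\mathcal{H}_\pi$ (same Haar measure $\mu$ as in the densities). Minimality. For $\Gamma\subseteq G$, $\pi(\Gamma)g$ denotes the family $(\pi(\gamma)g)_{\gamma\in\Gamma}$ (repetitions allowed). It is minimal if $\pi(\gamma)g \notin \overline{\operatorname{span}}\{\pi(\gamma')g : \gamma'\in\Gamma\setminus\{\gamma\}\}$ for every $\gamma\in\Gamma$. It is uniformly minimal if there is $\delta>0$ such that $\operatorname{dist}\big(\pi(\gamma)g, \overline{\operatorname{span}}\{\pi(\gamma')g : \gamma'\in\Gamma\setminus\{\gamma\}\}\big)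 \geq \delta$ for every $\gamma\in\Gamma$, where $\operatorname{dist}(f,S)=\inf_{h\in S}\|f-h\|$. *)

theory Defs
  imports "HOL-Analysis.Analysis" "HOL-Library.Set_Algebras"
begin

text \<open>
  Groups are written additively: the type class \<open>topological_group_add\<close> of the library does not
  assume commutativity.  So \<open>x + y\<close>, \<open>- x\<close> and \<open>0\<close> stand for the product, the inverse and the
  neutral element, and \<open>A + B\<close> (from \<open>HOL-Library.Set_Algebras\<close>) for the product set; in
  particular, \<open>\<Lambda> + \<Lambda>\<close> is the set of all products of two elements of \<open>\<Lambda>\<close>.  The order of the
  summands matters throughout.
\<close>

text \<open>
  The inner product is linear in the first argument.  Definiteness, and the fact that the norm is
  the one induced by \<open>cinner\<close>, are inherited from \<open>real_inner\<close>, see \<open>cinner_self\<close> below.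
\<close>

class chilbert_space = real_inner + complete_space +
  fixes scaleC :: "complex \<Rightarrow> 'a \<Rightarrow> 'a"
    and cinner :: "'a \<Rightarrow> 'a \<Rightarrow> complex"
  assumes scaleC_add_right: "scaleC a (x + y) = scaleC a x + scaleC a y"
    and scaleC_add_left: "scaleC (a + b) x = scaleC a x + scaleC b x"
    and scaleC_scaleC: "scaleC a (scaleC b x) = scaleC (a * b) x"
    and scaleR_scaleC: "scaleR r x = scaleC (of_real r) x"
    and cinner_commute: "cinner x y = cnj (cinner y x)"
    and cinner_add_left: "cinner (x + y) z = cinner x z + cinner y z"
    and cinner_scaleC_left: "cinner (scaleC a x) y = a * cinner x y"
    and inner_eq_Re_cinner: "inner x y = Re (cinner x y)"

lemma scaleC_one: "scaleC 1 x = (x :: 'h::chilbert_space)"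
  by (metis of_real_1 scaleR_one scaleR_scaleC)

global_interpretation complex_vector: vector_space "scaleC :: complex \<Rightarrow> 'h \<Rightarrow> 'h::chilbert_space"
  defines csubspace = complex_vector.subspace
    and cspan = complex_vector.span
  by unfold_locales (simp_all add: scaleC_add_right scaleC_add_left scaleC_scaleC scaleC_one)

lemma cinner_self: "cinner x x = of_real ((norm (x :: 'h::chilbert_space))\<^sup>2)"
proof (rule complex_eqI)
  show "Re (cinner x x) = Re (of_real ((norm x)\<^sup>2))"
    by (simp add: power2_norm_eq_inner inner_eq_Re_cinner)
  have "Im (cinner x x) = - Im (cinner x x)"
    using arg_cong[where f = Im, OF cinner_commute[of x x]] by simp
  then show "Im (cinner x x) = Im (of_real ((norm x)\<^sup>2))"
    by simp
qed

instantiation complex :: chilbert_space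
begin

definition scaleC_complex :: "complex \<Rightarrow> complex \<Rightarrow> complex" where
  "scaleC_complex a x = a * x"

definition cinner_complex :: "complex \<Rightarrow> complex \<Rightarrow> complex" where
  "cinner_complex x y = x * cnj y"

instance
  by standard
    (simp_all add: scaleC_complex_def cinner_complex_def algebra_simps scaleR_conv_of_real
      inner_complex_def)

end

definition unitary :: "('h::chilbert_space \<Rightarrow> 'h) \<Rightarrow> bool" where
  "unitary T \<longleftrightarrow>
     (\<forall>f h. T (f + h) = T f + T h) \<and> (\<forall>a f. T (scaleC a f) = scaleC a (T f)) \<and>
     (\<forall>f h. cinner (T f) (T h) = cinner f h) \<and> surj T"

definition radon_measure :: "'g::topological_space measure \<Rightarrow> bool" where
  "radon_measure \<mu> \<longleftrightarrow>
     sets \<mu> = sets borel \<and>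
     (\<forall>C. compact C \<longrightarrow> emeasure \<mu> C < \<infinity>) \<and>
     (\<forall>A\<in>sets borel. emeasure \<mu> A = (INF U\<in>{U. open U \<and> A \<subseteq> U}. emeasure \<mu> U)) \<and>
     (\<forall>U. open U \<longrightarrow> emeasure \<mu> U = (SUP C\<in>{C. compact C \<and> C \<subseteq> U}. emeasure \<mu> C))"

definition left_haar_measure :: "'g::topological_group_add measure \<Rightarrow> bool" where
  "left_haar_measure \<mu> \<longleftrightarrow>
     radon_measure \<mu> \<and> emeasure \<mu> UNIV \<noteq> 0 \<and>
     (\<forall>a. \<forall>A\<in>sets borel. emeasure \<mu> ((\<lambda>x. a + x) ` A) = emeasure \<mu> A)"

text \<open>
  For \<open>\<mu>\<close> a left Haar measure, the following says that the group is unimodular.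
\<close>

definition right_invariant :: "'g::topological_group_add measure \<Rightarrow> bool" where
  "right_invariant \<mu> \<longleftrightarrow>
     (\<forall>a. \<forall>A\<in>sets borel. emeasure \<mu> ((\<lambda>x. x + a) ` A) = emeasure \<mu> A)"

definition bounded_measurable :: "'g measure \<Rightarrow> ('g \<Rightarrow> real) set" where
  "bounded_measurable \<mu> = {f \<in> borel_measurable \<mu>. bounded (range f)}"

text \<open>
  Amenability: there is a left-invariant mean \<open>m\<close> on the real space \<open>L\<^sup>\<infinity>(G)\<close>.  Every class in this
  space has a bounded representative; the positivity condition, stated almost everywhere, makes
  \<open>m\<close> depend only on the class.
\<close>

definition amenable :: "'g::topological_group_add measure \<Rightarrow> bool" where
  "amenable \<mu> \<longleftrightarrow>
     (\<exists>m :: ('g \<Rightarrow> real) \<Rightarrow> real.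
        (\<forall>f\<in>bounded_measurable \<mu>. \<forall>h\<in>bounded_measurable \<mu>. m (\<lambda>x. f x + h x) = m f + m h) \<and>
        (\<forall>c. \<forall>f\<in>bounded_measurable \<mu>. m (\<lambda>x. c * f x) = c * m f) \<and>
        (\<forall>f\<in>bounded_measurable \<mu>. (AE x in \<mu>. 0 \<le> f x) \<longrightarrow> 0 \<le> m f) \<and>
        m (\<lambda>_. 1) = 1 \<and>
        (\<forall>a. \<forall>f\<in>bounded_measurable \<mu>. m (\<lambda>x. f (a + x)) = m f))"

definition locally_finite :: "'g::topological_space set \<Rightarrow> bool" where
  "locally_finite \<Lambda> \<longleftrightarrow> closed \<Lambda> \<and> discrete \<Lambda>"

definition relatively_dense :: "'g::topological_group_add set \<Rightarrow> bool" where
  "relatively_dense \<Lambda> \<longleftrightarrow> (\<exists>C. compact C \<and> \<Lambda> + C = UNIV)"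

definition uniformly_discrete :: "'g::topological_group_add set \<Rightarrow> bool" where
  "uniformly_discrete \<Lambda> \<longleftrightarrow>
     (\<exists>V. open V \<and> V \<noteq> {} \<and>
        (\<forall>x. finite (\<Lambda> \<inter> (\<lambda>v. x + v) ` V) \<and> card (\<Lambda> \<inter> (\<lambda>v. x + v) ` V) \<le> 1))"

definition delone :: "'g::topological_group_add set \<Rightarrow> bool" where
  "delone \<Lambda> \<longleftrightarrow> relatively_dense \<Lambda> \<and> uniformly_discrete \<Lambda>"

definition approximate_subgroup :: "nat \<Rightarrow> 'g::group_add set \<Rightarrow> bool" where
  "approximate_subgroup k \<Lambda> \<longleftrightarrow>
     0 \<in> \<Lambda> \<and> uminus ` \<Lambda> = \<Lambda> \<and> (\<exists>F. finite F \<and> card F \<le> k \<and> \<Lambda> + \<Lambda> \<subseteq> F + \<Lambda>)"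

definition uniform_approximate_lattice :: "nat \<Rightarrow> 'g::topological_group_add set \<Rightarrow> bool" where
  "uniform_approximate_lattice k \<Lambda> \<longleftrightarrow> approximate_subgroup k \<Lambda> \<and> delone \<Lambda>"

text \<open>
  The test set \<open>C\<close> has to be non-empty: for \<open>C = {}\<close> the first quotient is constantly 1.
  All measures below are finite for a Haar measure, since \<open>K n\<close> and \<open>K n + C\<close> are compact.
\<close>

definition strong_Folner_sequence ::
    "'g::topological_group_add measure \<Rightarrow> (nat \<Rightarrow> 'g set) \<Rightarrow> bool" where
  "strong_Folner_sequence \<mu> K \<longleftrightarrow>
     (\<forall>n. compact (K n) \<and> measure \<mu> (K n) > 0) \<and>
     (\<forall>C. compact C \<and> C \<noteq> {} \<longrightarrow>
        (\<lambda>n. measure \<mu> (sym_diff (K n) (K n + C)) / measure \<mu> (K n)) \<longlonglongrightarrow> 0 \<and>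
        (\<lambda>n. measure \<mu> ((K n + C) \<inter> ((UNIV - K n) + C)) / measure \<mu> (K n)) \<longlonglongrightarrow> 0)"

text \<open>
  The counting measure is used instead of \<open>card\<close> because \<open>card\<close> of an infinite set is 0.
\<close>

definition upper_Beurling_density ::
    "'g::topological_group_add measure \<Rightarrow> (nat \<Rightarrow> 'g set) \<Rightarrow> 'g set \<Rightarrow> ennreal" where
  "upper_Beurling_density \<mu> K \<Lambda> =
     limsup (\<lambda>n. SUP x. emeasure (count_space UNIV) (\<Lambda> \<inter> (\<lambda>y. x + y) ` K n) / emeasure \<mu> (K n))"

definition projective_unitary_rep ::
    "('g::topological_group_add \<Rightarrow> 'h::chilbert_space \<Rightarrow> 'h) \<Rightarrow> bool" where
  "projective_unitary_rep \<pi> \<longleftrightarrow>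
     (\<forall>x. unitary (\<pi> x)) \<and>
     (\<forall>f. continuous_on UNIV (\<lambda>x. \<pi> x f)) \<and>
     (\<exists>\<sigma> :: 'g \<Rightarrow> 'g \<Rightarrow> complex.
        (\<forall>x y. cmod (\<sigma> x y) = 1) \<and>
        (\<forall>x y f. \<pi> x (\<pi> y f) = scaleC (\<sigma> x y) (\<pi> (x + y) f)))"

text \<open>
  On a non-zero space, the multiplier \<open>\<sigma>\<close> is automatically a 2-cocycle.
\<close>

lemma multiplier_cocycle:
  fixes \<pi> :: "'g::topological_group_add \<Rightarrow> 'h::chilbert_space \<Rightarrow> 'h"
  assumes unitary: "\<And>x. unitary (\<pi> x)"
    and mult: "\<And>x y f. \<pi> x (\<pi> y f) = scaleC (\<sigma> x y) (\<pi> (x + y) f)"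
    and nonzero: "(f :: 'h) \<noteq> 0"
  shows "\<sigma> x y * \<sigma> (x + y) z = \<sigma> y z * \<sigma> x (y + z)"
proof -
  have "cinner (\<pi> (x + y + z) f) (\<pi> (x + y + z) f) = cinner f f"
    using unitary[of "x + y + z"] unfolding unitary_def by blast
  then have neq: "\<pi> (x + y + z) f \<noteq> 0"
    using nonzero by (auto simp: cinner_self)
  have "\<pi> x (\<pi> y (\<pi> z f)) = scaleC (\<sigma> x y * \<sigma> (x + y) z) (\<pi> (x + y + z) f)"
    by (simp only: mult[of x y] mult[of "x + y" z] scaleC_scaleC)
  moreover have "\<pi> x (\<pi> y (\<pi> z f)) = scaleC (\<sigma> y z) (\<pi> x (\<pi> (y + z) f))"
    using unitary[of x] by (simp only: mult[of y z] unitary_def)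
  then have "\<pi> x (\<pi> y (\<pi> z f)) = scaleC (\<sigma> y z * \<sigma> x (y + z)) (\<pi> (x + y + z) f)"
    by (simp only: mult[of x "y + z"] scaleC_scaleC add.assoc)
  ultimately show ?thesis
    using neq by simp
qed

definition irreducible_rep :: "('g \<Rightarrow> 'h::chilbert_space \<Rightarrow> 'h) \<Rightarrow> bool" where
  "irreducible_rep \<pi> \<longleftrightarrow>
     (\<forall>W. csubspace W \<and> closed W \<and> (\<forall>x. \<pi> x ` W \<subseteq> W) \<longrightarrow> W = {0} \<or> W = UNIV)"

definition square_integrable_rep ::
    "'g measure \<Rightarrow> ('g \<Rightarrow> 'h::chilbert_space \<Rightarrow> 'h) \<Rightarrow> bool" where
  "square_integrable_rep \<mu> \<pi> \<longleftrightarrow>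
     (\<exists>g. g \<noteq> 0 \<and> (\<integral>\<^sup>+ x. ennreal ((cmod (cinner g (\<pi> x g)))\<^sup>2) \<partial>\<mu>) < \<infinity>)"

definition is_formal_degree ::
    "'g measure \<Rightarrow> ('g \<Rightarrow> 'h::chilbert_space \<Rightarrow> 'h) \<Rightarrow> real \<Rightarrow> bool" where
  "is_formal_degree \<mu> \<pi> d \<longleftrightarrow>
     d > 0 \<and>
     (\<forall>f g. (\<integral>\<^sup>+ x. ennreal ((cmod (cinner f (\<pi> x g)))\<^sup>2) \<partial>\<mu>) =
        ennreal (inverse d * (norm f)\<^sup>2 * (norm g)\<^sup>2))"

definition minimal_orbit :: "('g \<Rightarrow> 'h::chilbert_space \<Rightarrow> 'h) \<Rightarrow> 'g set \<Rightarrow> 'h \<Rightarrow> bool" where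
  "minimal_orbit \<pi> \<Gamma> g \<longleftrightarrow>
     (\<forall>\<gamma>\<in>\<Gamma>. \<pi> \<gamma> g \<notin> closure (cspan ((\<lambda>\<gamma>'. \<pi> \<gamma>' g) ` (\<Gamma> - {\<gamma>}))))"

definition uniformly_minimal_orbit ::
    "('g \<Rightarrow> 'h::chilbert_space \<Rightarrow> 'h) \<Rightarrow> 'g set \<Rightarrow> 'h \<Rightarrow> bool" where
  "uniformly_minimal_orbit \<pi> \<Gamma> g \<longleftrightarrow>
     (\<exists>\<delta>>0. \<forall>\<gamma>\<in>\<Gamma>. infdist (\<pi> \<gamma> g) (closure (cspan ((\<lambda>\<gamma>'. \<pi> \<gamma>' g) ` (\<Gamma> - {\<gamma>})))) \<ge> \<delta>)"

end

theory Submission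
  imports Defs
begin

text \<open>
  Let \<open>\<eta>\<close> be a unit vector and \<open>Q\<close> a compact set, and let \<open>P\<close> be the orthogonal projection onto the
  span of the \<open>n\<close> vectors \<open>\<pi> \<lambda> g\<close> with \<open>\<lambda> \<in> \<Lambda> \<inter> Q\<close>.  By the orthogonality relations, the integral
  of \<open>\<langle>P (\<pi> y \<eta>), \<pi> y \<eta>\<rangle>\<close> over \<open>y\<close> is the trace of \<open>P\<close> divided by \<open>d\<close>, that is \<open>n / d\<close>.  The
  integrand is at most 1, so the part over \<open>Q + C\<close> contributes at most \<open>\<mu> (Q + C)\<close>.  Outside, expand
  \<open>P\<close> along the basis \<open>\<pi> \<lambda> g\<close> and its dual basis in the span: uniform minimality bounds the dual
  basis, while \<open>\<langle>\<pi> \<lambda> g, \<pi> y \<eta>\<rangle>\<close> is a translate of the square-integrable function \<open>\<langle>g, \<pi> y \<eta>\<rangle>\<close>,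
  whose mass outside a large compact set \<open>C\<close> is small.  Hence \<open>(1 - \<tau>) n \<le> d \<mu> (Q + C)\<close>, and the
  Folner property gives (i).

  For (ii), translating by \<open>- \<lambda>\<close> shows that minimality of \<open>\<pi> (\<Lambda> + \<Lambda>) g\<close> at the single point 0
  already makes \<open>\<pi> \<Lambda> g\<close> uniformly minimal, and \<open>\<Lambda> + \<Lambda>\<close> is covered by \<open>k\<close> translates of \<open>\<Lambda>\<close>.
\<close>

section \<open>Complex inner products and dual families\<close>

lemma cinner_add_right: "cinner (x :: 'h::chilbert_space) (y + z) = cinner x y + cinner x z"
  by (metis cinner_add_left cinner_commute complex_cnj_add)

lemma cinner_scaleC_right: "cinner (x :: 'h::chilbert_space) (scaleC a y) = cnj a * cinner x y"
  by (metis cinner_scaleC_left cinner_commute complex_cnj_mult)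

lemma scaleC_minus_one: "scaleC (- 1) x = - (x :: 'h::chilbert_space)"
  using scaleR_scaleC[of "-1" x] by simp

lemma cinner_minus_left: "cinner (- x) (y :: 'h::chilbert_space) = - cinner x y"
  by (metis cinner_scaleC_left scaleC_minus_one mult_minus1)

lemma cinner_diff_left: "cinner (x - y) (z :: 'h::chilbert_space) = cinner x z - cinner y z"
  by (metis cinner_add_left cinner_minus_left diff_conv_add_uminus)

lemma cinner_minus_right: "cinner (y :: 'h::chilbert_space) (- x) = - cinner y x"
  by (metis cinner_minus_left cinner_commute complex_cnj_minus)

lemma cinner_diff_right: "cinner (z :: 'h::chilbert_space) (x - y) = cinner z x - cinner z y"
  by (metis cinner_add_right cinner_minus_right diff_conv_add_uminus)

lemma cinner_zero_left [simp]: "cinner 0 (x :: 'h::chilbert_space) = 0"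
  using cinner_diff_left[of x x x] by simp

lemma cinner_zero_right [simp]: "cinner (x :: 'h::chilbert_space) 0 = 0"
  using cinner_diff_right[of x x x] by simp

lemma cinner_sum_left:
  "cinner (\<Sum>i\<in>I. v i) (x :: 'h::chilbert_space) = (\<Sum>i\<in>I. cinner (v i) x)"
  by (induction I rule: infinite_finite_induct) (simp_all add: cinner_add_left)

lemma norm_scaleC: "norm (scaleC a (x :: 'h::chilbert_space)) = cmod a * norm x"
proof -
  have "complex_of_real ((norm (scaleC a x))\<^sup>2) = (a * cnj a) * cinner x x"
    unfolding cinner_self[symmetric] by (simp add: cinner_scaleC_left cinner_scaleC_right)
  also have "\<dots> = complex_of_real ((cmod a * norm x)\<^sup>2)"
    by (simp only: cinner_self[of x] complex_norm_square[symmetric] of_real_mult[symmetric]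
        power_mult_distrib)
  finally have "complex_of_real ((norm (scaleC a x))\<^sup>2) = complex_of_real ((cmod a * norm x)\<^sup>2)" .
  then have "(norm (scaleC a x))\<^sup>2 = (cmod a * norm x)\<^sup>2"
    by (simp only: of_real_eq_iff)
  then show ?thesis by (rule power2_eq_imp_eq) simp_all
qed

lemma unitary_norm: "unitary T \<Longrightarrow> norm (T f) = norm f"
proof -
  assume "unitary T"
  then have "cinner (T f) (T f) = cinner f f"
    unfolding unitary_def by blast
  then show "norm (T f) = norm f"
    by (simp add: cinner_self flip: of_real_power)
qed

lemma unitary_diff: "unitary T \<Longrightarrow> T (f - h) = T f - T h"
  unfolding unitary_def by (metis add_diff_cancel_right' diff_add_cancel)

text \<open>The real inner product is already known to be continuous, and it recovers the complex
  one: multiplying the first argument by \<open>- \<i>\<close> turns the imaginary part into a real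
  part.\<close>

lemma continuous_on_cinner_right:
  assumes "continuous_on S u"
  shows "continuous_on S (\<lambda>y. cinner (f :: 'h::chilbert_space) (u y))"
proof -
  have eq: "cinner f w = Complex (inner f w) (inner (scaleC (- \<i>) f) w)" for w
    by (rule complex_eqI) (simp_all add: inner_eq_Re_cinner cinner_minus_left cinner_scaleC_left)
  show ?thesis
    unfolding eq Complex_eq by (intro continuous_intros assms)
qed

text \<open>Gram-Schmidt by induction on \<open>S\<close>: the new vector \<open>a\<close> is
  replaced by its component \<open>q\<close> orthogonal to the old span, and the old projection of
  \<open>f\<close> is corrected along \<open>q\<close>.\<close>

lemma exists_orthogonal_projection:
  fixes S :: "'h::chilbert_space set"
  assumes "finite S"
  shows "\<exists>p\<in>cspan S. \<forall>s\<in>cspan S. cinner (f - p) s = 0"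
  using assms
proof (induction S arbitrary: f rule: finite_induct)
  case empty
  then show ?case by simp
next
  case (insert a S)
  obtain pa where pa: "pa \<in> cspan S" "\<forall>s\<in>cspan S. cinner (a - pa) s = 0"
    using insert.IH by blast
  obtain p where p: "p \<in> cspan S" "\<forall>s\<in>cspan S. cinner (f - p) s = 0"
    using insert.IH by blast
  define q where "q = a - pa"
  \<comment> \<open>If \<open>a\<close> already lies in the old span, then \<open>q = 0\<close>.
    Division by zero gives \<open>c = 0\<close>, so the projection stays unchanged and no case
    distinction is needed in the definition.\<close>
  define c where "c = cinner f q / cinner q q"
  have mono: "cspan S \<subseteq> cspan (insert a S)"
    by (rule complex_vector.span_mono) auto
  have q: "q \<in> cspan (insert a S)"
    unfolding q_def
    by (rule complex_vector.span_diff[OF complex_vector.span_base subsetD[OF mono pa(1)]]) simp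
  have "cinner p q = 0"
    using pa(2) p(1) cinner_commute[of p q] by (simp add: q_def)
  then have fq: "cinner (f - (p + scaleC c q)) q = 0"
    by (cases "q = 0")
      (simp_all add: cinner_diff_left cinner_add_left cinner_scaleC_left c_def cinner_self)
  have fs: "cinner (f - (p + scaleC c q)) s = 0" if "s \<in> cspan S" for s
  proof -
    have "cinner (f - p) s = 0" "cinner q s = 0"
      using that p(2) pa(2) by (auto simp: q_def)
    then show ?thesis
      by (simp add: cinner_diff_left cinner_add_left cinner_scaleC_left)
  qed
  have "cinner (f - (p + scaleC c q)) s = 0" if s: "s \<in> cspan (insert a S)" for s
  proof -
    obtain k where "s - scaleC k a \<in> cspan S"
      using s by (auto simp: complex_vector.span_insert)
    then have "(s - scaleC k a) + scaleC k pa \<in> cspan S"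
      using pa(1) by (intro complex_vector.span_add complex_vector.span_scale)
    moreover have "s = ((s - scaleC k a) + scaleC k pa) + scaleC k q"
      by (simp add: q_def complex_vector.scale_right_diff_distrib)
    ultimately show ?thesis
      using fs fq by (metis add_0 cinner_add_right cinner_scaleC_right mult_zero_right)
  qed
  moreover have "p + scaleC c q \<in> cspan (insert a S)"
    using q mono p(1) by (intro complex_vector.span_add complex_vector.span_scale) auto
  ultimately show ?case by blast
qed

text \<open>The dual vector \<open>h i\<close> is the residual \<open>q i\<close> of
  \<open>v i\<close> modulo the span of the other vectors, divided by its squared norm. Since
  \<open>q i\<close> has norm at least \<open>\<delta>\<close>, this gives the bound
  \<open>1 / \<delta>\<close>. The sum in the last clause is the squared norm of the projection of
  \<open>f\<close> onto the span of all \<open>v i\<close>.\<close>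

lemma exists_dual_family:
  fixes v :: "'i \<Rightarrow> 'h::chilbert_space"
  assumes I: "finite I" and "\<delta> > 0"
    and sep: "\<And>i p. i \<in> I \<Longrightarrow> p \<in> cspan (v ` (I - {i})) \<Longrightarrow> \<delta> \<le> norm (v i - p)"
  shows "\<exists>h. (\<forall>i\<in>I. norm (h i) \<le> 1 / \<delta>) \<and> (\<forall>i\<in>I. cinner (v i) (h i) = 1) \<and>
    (\<forall>f. (\<Sum>i\<in>I. Re (cinner (v i) f * cinner f (h i))) \<le> (norm f)\<^sup>2)"
proof -
  have "\<forall>i. \<exists>p\<in>cspan (v ` (I - {i})). \<forall>s\<in>cspan (v ` (I - {i})). cinner (v i - p) s = 0"
    using I by (intro allI exists_orthogonal_projection) auto
  then obtain P where P: "\<And>i. P i \<in> cspan (v ` (I - {i}))"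
    and orth: "\<And>i s. s \<in> cspan (v ` (I - {i})) \<Longrightarrow> cinner (v i - P i) s = 0"
    by metis
  define q where "q i = v i - P i" for i
  define h where "h i = scaleR (1 / (norm (q i))\<^sup>2) (q i)" for i
  have hC: "h i = scaleC (of_real (1 / (norm (q i))\<^sup>2)) (q i)" for i
    by (simp only: h_def scaleR_scaleC)
  have q: "\<delta> \<le> norm (q i)" if "i \<in> I" for i
    using sep that P by (simp add: q_def)
  have "norm (h i) \<le> 1 / \<delta>" if "i \<in> I" for i
  proof -
    have "norm (h i) = 1 / norm (q i)"
      using q[OF that] \<open>\<delta> > 0\<close>
      by (simp add: h_def power2_eq_square)
    then show ?thesis
      using q[OF that] \<open>\<delta> > 0\<close> by (simp add: frac_le)
  qed
  moreover have dual: "cinner (v j) (h i) = (if i = j then 1 else 0)"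
    if "i \<in> I" "j \<in> I" for i j
  proof (cases "i = j")
    case True
    have "cinner (P i) (q i) = 0"
      using orth[OF P] cinner_commute[of "P i" "q i"] by (simp add: q_def)
    then have "cinner (v i) (q i) = cinner (q i) (q i)"
      by (simp add: q_def cinner_diff_left)
    then show ?thesis
      using q[OF that(1)] \<open>\<delta> > 0\<close> True by (auto simp: hC cinner_scaleC_right cinner_self)
  next
    case False
    then have "cinner (q i) (v j) = 0"
      unfolding q_def using that by (intro orth complex_vector.span_base) auto
    then show ?thesis
      using cinner_commute[of "v j" "q i"] False by (simp add: hC cinner_scaleC_right)
  qed
  moreover have "(\<Sum>i\<in>I. Re (cinner (v i) f * cinner f (h i))) \<le> (norm f)\<^sup>2" for f
  proof -
    obtain p where p: "p \<in> cspan (v ` I)" and orth_p: "\<And>s. s \<in> cspan (v ` I) \<Longrightarrow> cinner (f - p) s = 0"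
      using exists_orthogonal_projection[of "v ` I" f] I by blast
    have h: "h i \<in> cspan (v ` I)" if "i \<in> I" for i
    proof -
      have "P i \<in> cspan (v ` I)"
        using P[of i] complex_vector.span_mono[of "v ` (I - {i})" "v ` I"] by blast
      then show ?thesis
        unfolding hC q_def using that
        by (intro complex_vector.span_scale complex_vector.span_diff)
          (simp_all add: complex_vector.span_base)
    qed
    have fh: "cinner f (h i) = cinner p (h i)" if "i \<in> I" for i
      using orth_p[OF h[OF that]] by (simp add: cinner_diff_left)
    \<comment> \<open>Biorthogonality gives the reproducing formula on each \<open>v j\<close>, and
      linearity extends it to the span.\<close>
    have "(\<Sum>i\<in>I. scaleC (cinner x (h i)) (v i)) = x" if "x \<in> cspan (v ` I)" for x
      using that
    proof (induction rule: complex_vector.span_induct_alt)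
      case base
      then show ?case by simp
    next
      case (step c x y)
      then obtain j where j: "j \<in> I" "x = v j" by blast
      have "(\<Sum>i\<in>I. scaleC (cinner x (h i)) (v i)) = (\<Sum>i\<in>I. if i = j then v j else 0)"
        using j dual by (intro sum.cong) (auto simp: scaleC_one)
      also have "\<dots> = x"
        using I j by simp
      finally have "(\<Sum>i\<in>I. scaleC (c * cinner x (h i)) (v i)) = scaleC c x"
        by (simp only: complex_vector.scale_sum_right[symmetric] scaleC_scaleC[symmetric])
      then show ?case
        using step by (simp only: cinner_add_left cinner_scaleC_left scaleC_add_left sum.distrib)
    qed
    then have Pp: "(\<Sum>i\<in>I. scaleC (cinner p (h i)) (v i)) = p"
      using p by blast
    have "(\<Sum>i\<in>I. cinner (v i) f * cinner f (h i)) =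
        cinner (\<Sum>i\<in>I. scaleC (cinner p (h i)) (v i)) f"
      by (simp add: cinner_sum_left cinner_scaleC_left fh mult.commute)
    then have "(\<Sum>i\<in>I. Re (cinner (v i) f * cinner f (h i))) = inner p f"
      unfolding Pp by (metis Re_sum inner_eq_Re_cinner)
    moreover have "inner (f - p) p = 0"
      using orth_p[OF p] by (simp add: inner_eq_Re_cinner)
    then have pf: "inner p f = (norm p)\<^sup>2"
      by (simp add: inner_diff_left inner_commute[of p f] power2_norm_eq_inner)
    moreover have "norm p \<le> norm f"
      using norm_cauchy_schwarz[of p f] pf
      by (cases "p = 0") (auto simp: power2_eq_square)
    ultimately show ?thesis by (simp add: power_mono)
  qed
  ultimately show ?thesis by (intro exI[of _ h] conjI ballI allI) simp_all
qed

section \<open>Counting vectors by integration over a continuous tight frame\<close>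

text \<open>The frame identity for \<open>f + h\<close> and \<open>f - h\<close> is subtracted.
  Taking real parts leaves just these two terms of the polarization identity.\<close>

lemma frame_polarization:
  fixes W :: "'a \<Rightarrow> 'h::chilbert_space"
  assumes meas: "\<And>f. (\<lambda>y. cinner f (W y)) \<in> borel_measurable M"
    and d: "d > 0"
    and frame: "\<And>f. (\<integral>\<^sup>+ y. ennreal ((cmod (cinner f (W y)))\<^sup>2) \<partial>M) = ennreal ((norm f)\<^sup>2 / d)"
  shows "has_bochner_integral M (\<lambda>y. Re (cinner f (W y) * cinner (W y) h)) (inner f h / d)"
proof -
  have sq: "has_bochner_integral M (\<lambda>y. (cmod (cinner u (W y)))\<^sup>2) ((norm u)\<^sup>2 / d)" for u
    using frame[of u] d meas[of u] by (intro has_bochner_integral_nn_integral) auto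
  have "Re (cinner f w * cinner w h) =
      ((cmod (cinner (f + h) w))\<^sup>2 - (cmod (cinner (f - h) w))\<^sup>2) / 4" for w
    unfolding cinner_commute[of w h] cinner_add_left cinner_diff_left cmod_power2
    by (simp add: algebra_simps power2_eq_square)
  moreover have "inner f h / d = ((norm (f + h))\<^sup>2 / d - (norm (f - h))\<^sup>2 / d) / 4"
    using d by (simp add: power2_norm_eq_inner inner_add_left inner_add_right
        inner_diff_left inner_diff_right inner_commute field_simps)
  ultimately show ?thesis
    using has_bochner_integral_divide_zero[OF has_bochner_integral_diff[OF sq[of "f + h"] sq[of "f - h"]], of 4]
    by (simp only:)
qed

text \<open>The trace of the projection onto the span of the \<open>v i\<close> is computed by
  integrating its frame expansion. Each index contributes \<open>1 / d\<close>, because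
  \<open>v i\<close> and \<open>h i\<close> pair to 1. The part over \<open>A\<close> is at most the
  measure of \<open>A\<close>, and the tail bound keeps the rest below
  \<open>\<tau> * card I / d\<close>.\<close>

lemma card_le_measure_of_frame:
  fixes W :: "'a \<Rightarrow> 'h::chilbert_space" and v :: "'i \<Rightarrow> 'h"
  assumes meas: "\<And>f. (\<lambda>y. cinner f (W y)) \<in> borel_measurable M"
    and d: "d > 0"
    and frame: "\<And>f. (\<integral>\<^sup>+ y. ennreal ((cmod (cinner f (W y)))\<^sup>2) \<partial>M) = ennreal ((norm f)\<^sup>2 / d)"
    and W: "\<And>y. norm (W y) \<le> 1"
    and A: "A \<in> sets M" "emeasure M A < \<infinity>"
    and I: "finite I" and \<delta>: "\<delta> > 0"
    and sep: "\<And>i p. i \<in> I \<Longrightarrow> p \<in> cspan (v ` (I - {i})) \<Longrightarrow> \<delta> \<le> norm (v i - p)"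
    and \<tau>: "\<tau> > 0"
    and tail: "\<And>i. i \<in> I \<Longrightarrow>
      (\<integral>\<^sup>+ y. ennreal ((cmod (cinner (v i) (W y)))\<^sup>2 * indicator (- A) y) \<partial>M)
        \<le> ennreal ((\<tau> * \<delta>)\<^sup>2 / d)"
  shows "(1 - \<tau>) * real (card I) \<le> d * measure M A"
proof -
  have "\<exists>h. (\<forall>i\<in>I. norm (h i) \<le> 1 / \<delta>) \<and> (\<forall>i\<in>I. cinner (v i) (h i) = 1) \<and>
    (\<forall>f. (\<Sum>i\<in>I. Re (cinner (v i) f * cinner f (h i))) \<le> (norm f)\<^sup>2)"
    by (rule exists_dual_family[OF I \<delta>]) (rule sep)
  then obtain h where h: "\<And>i. i \<in> I \<Longrightarrow> norm (h i) \<le> 1 / \<delta>" "\<And>i. i \<in> I \<Longrightarrow> cinner (v i) (h i) = 1"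
    and le: "\<And>f. (\<Sum>i\<in>I. Re (cinner (v i) f * cinner f (h i))) \<le> (norm f)\<^sup>2"
    by blast
  \<comment> \<open>This weight balances the arithmetic-geometric mean inequality used below: the
    tail of \<open>v i\<close> divided by \<open>t\<close> and the full mass of \<open>h i\<close>
    times \<open>t\<close> are both at most \<open>\<tau> / d\<close> after integration.\<close>
  define t where "t = \<tau> * \<delta>\<^sup>2"
  have t: "t > 0" using \<tau> \<delta> by (simp add: t_def)
  define F where "F i y = Re (cinner (v i) (W y) * cinner (W y) (h i))" for i y
  define a where "a i y = (cmod (cinner (v i) (W y)))\<^sup>2 * indicator (- A) y" for i y
  define b where "b i y = (cmod (cinner (h i) (W y)))\<^sup>2" for i y
  have F: "has_bochner_integral M (F i) (1 / d)" if "i \<in> I" for i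
    using frame_polarization[OF meas d frame, of "v i" "h i"] h(2)[OF that]
    by (simp add: F_def[abs_def] inner_eq_Re_cinner)
  have b: "has_bochner_integral M (b i) ((norm (h i))\<^sup>2 / d)" for i
    unfolding b_def using frame[of "h i"] d meas[of "h i"]
    by (intro has_bochner_integral_nn_integral) auto
  have am: "a i \<in> borel_measurable M" for i
    unfolding a_def using meas A(1) by measurable
  have ai: "integrable M (a i)" and a_le: "integral\<^sup>L M (a i) \<le> (\<tau> * \<delta>)\<^sup>2 / d" if "i \<in> I" for i
  proof -
    have nn: "(\<integral>\<^sup>+ y. ennreal (a i y) \<partial>M) \<le> ennreal ((\<tau> * \<delta>)\<^sup>2 / d)"
      using tail[OF that] by (simp add: a_def)
    show "integrable M (a i)"
      using nn am by (intro integrableI_nonneg) (auto simp: a_def less_top[symmetric] top_unique)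
    then have "ennreal (integral\<^sup>L M (a i)) = (\<integral>\<^sup>+ y. ennreal (a i y) \<partial>M)"
      by (subst nn_integral_eq_integral) (auto simp: a_def)
    then show "integral\<^sup>L M (a i) \<le> (\<tau> * \<delta>)\<^sup>2 / d"
      using nn d by (subst ennreal_le_iff[symmetric]) simp_all
  qed
  \<comment> \<open>On \<open>A\<close> the left side is at most the squared norm of
    \<open>W y\<close>, hence at most 1. Off \<open>A\<close> each summand is bounded separately by
    Cauchy's inequality with weight \<open>t\<close>. The cutoff sits only in \<open>a\<close>; the
    term with \<open>b\<close> is nonnegative and can stay on \<open>A\<close> as well.\<close>
  have pt: "(\<Sum>i\<in>I. F i y) \<le> indicator A y + (\<Sum>i\<in>I. (a i y / t + t * b i y) / 2)" for y
  proof (cases "y \<in> A")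
    case True
    have "(norm (W y))\<^sup>2 \<le> 1" using W[of y] by (simp add: power_le_one)
    then have "(\<Sum>i\<in>I. F i y) \<le> 1" using le[of "W y"] by (simp add: F_def)
    moreover have "0 \<le> (\<Sum>i\<in>I. (a i y / t + t * b i y) / 2)"
      using t by (intro sum_nonneg) (simp add: a_def b_def)
    ultimately show ?thesis using True by simp
  next
    case False
    have "F i y \<le> (a i y / t + t * b i y) / 2" for i
    proof -
      define r s where "r = cmod (cinner (v i) (W y))" and "s = cmod (cinner (h i) (W y))"
      have "F i y \<le> r * s"
        unfolding F_def r_def s_def cinner_commute[of "W y" "h i"]
        by (metis complex_Re_le_cmod norm_mult complex_mod_cnj)
      also have "\<dots> \<le> (r\<^sup>2 / t + t * s\<^sup>2) / 2"
      proof -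
        have "0 \<le> (r - t * s)\<^sup>2" by simp
        then show ?thesis using t by (simp add: power2_eq_square field_simps)
      qed
      finally show ?thesis using False by (simp add: a_def b_def r_def s_def)
    qed
    then show ?thesis using False by (simp add: sum_mono)
  qed
  have hb1: "has_bochner_integral M (\<lambda>y. \<Sum>i\<in>I. F i y) (\<Sum>i\<in>I. 1 / d)"
    using F by (rule has_bochner_integral_sum)
  have "has_bochner_integral M (\<lambda>y. (a i y / t + t * b i y) / 2)
      ((integral\<^sup>L M (a i) / t + t * ((norm (h i))\<^sup>2 / d)) / 2)" if "i \<in> I" for i
    by (intro has_bochner_integral_divide_zero has_bochner_integral_add
        has_bochner_integral_mult_right has_bochner_integral_integrable ai that b)
  moreover have "has_bochner_integral M (indicator A) (measure M A)"
    using A by (intro has_bochner_integral_real_indicator) auto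
  ultimately have hb2: "has_bochner_integral M
      (\<lambda>y. indicator A y + (\<Sum>i\<in>I. (a i y / t + t * b i y) / 2))
      (measure M A + (\<Sum>i\<in>I. (integral\<^sup>L M (a i) / t + t * ((norm (h i))\<^sup>2 / d)) / 2))"
    by (intro has_bochner_integral_add has_bochner_integral_sum) auto
  have "real (card I) / d = (\<Sum>i\<in>I. 1 / d)"
    by simp
  also have "\<dots> = (\<integral>y. (\<Sum>i\<in>I. F i y) \<partial>M)"
    by (rule has_bochner_integral_integral_eq[OF hb1, symmetric])
  also have "\<dots> \<le> (\<integral>y. indicator A y + (\<Sum>i\<in>I. (a i y / t + t * b i y) / 2) \<partial>M)"
    by (intro integral_mono pt integrable.intros[OF hb1] integrable.intros[OF hb2])
  also have "\<dots> = measure M A + (\<Sum>i\<in>I. (integral\<^sup>L M (a i) / t + t * ((norm (h i))\<^sup>2 / d)) / 2)"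
    by (rule has_bochner_integral_integral_eq[OF hb2])
  also have "\<dots> \<le> measure M A + (\<Sum>i\<in>I. \<tau> / d)"
  proof (intro add_left_mono sum_mono)
    fix i assume i: "i \<in> I"
    have "integral\<^sup>L M (a i) / t \<le> \<tau> / d"
      using a_le[OF i] t d by (simp add: t_def power2_eq_square field_simps)
    moreover have "(norm (h i))\<^sup>2 \<le> (1 / \<delta>)\<^sup>2"
      using h(1)[OF i] by (intro power_mono) auto
    then have "t * ((norm (h i))\<^sup>2 / d) \<le> t * ((1 / \<delta>)\<^sup>2 / d)"
      using t d by (intro mult_left_mono divide_right_mono) auto
    moreover have "t * ((1 / \<delta>)\<^sup>2 / d) = \<tau> / d"
      using \<delta> by (simp add: t_def power2_eq_square)
    ultimately have "integral\<^sup>L M (a i) / t + t * ((norm (h i))\<^sup>2 / d) \<le> \<tau> / d + \<tau> / d"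
      by (metis add_mono)
    then show "(integral\<^sup>L M (a i) / t + t * ((norm (h i))\<^sup>2 / d)) / 2 \<le> \<tau> / d"
      by (simp only: divide_le_eq_numeral1 mult_2_right)
  qed
  finally show ?thesis using d by (simp add: field_simps)
qed

section \<open>Haar measure on locally compact groups\<close>

lemma compact_set_plus:
  fixes A B :: "'a::topological_monoid_add set"
  assumes "compact A" "compact B"
  shows "compact (A + B)"
proof -
  have "A + B = (\<lambda>z. fst z + snd z) ` (A \<times> B)"
    by (force simp: set_plus_def)
  moreover have "compact ((\<lambda>z. fst z + snd z) ` (A \<times> B))"
    by (intro compact_continuous_image continuous_intros compact_Times assms)
  ultimately show ?thesis by simp
qed

text \<open>Open sets contained in compact sets cover the space. Lindelof's theorem extracts a
  countable subcover, and finite unions of the enclosing compact sets exhaust the space.\<close>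

lemma locally_compact_exhaustion:
  assumes "locally compact (UNIV :: 'a::second_countable_topology set)"
  obtains C :: "nat \<Rightarrow> 'a::second_countable_topology set"
    where "\<And>n. compact (C n)" "incseq C" "(\<Union>n. C n) = UNIV"
proof -
  define \<U> where "\<U> = {U :: 'a set. open U \<and> (\<exists>V. compact V \<and> U \<subseteq> V)}"
  have "\<Union>\<U> = UNIV"
  proof (intro equalityI subset_UNIV subsetI)
    fix x :: 'a
    obtain U V where "openin (top_of_set UNIV) U" "compact V" "x \<in> U" "U \<subseteq> V"
      using assms unfolding locally_def by (metis UNIV_I openin_subtopology_self subtopology_UNIV)
    then have "U \<in> \<U>" by (auto simp: \<U>_def)
    then show "x \<in> \<Union>\<U>" using \<open>x \<in> U\<close> by blast
  qed
  moreover obtain \<V> where \<V>: "\<V> \<subseteq> \<U>" "countable \<V>" "\<Union>\<V> = \<Union>\<U>"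
    using Lindelof[of \<U>] unfolding \<U>_def by blast
  ultimately have "\<V> \<noteq> {}" and cover: "\<Union>\<V> = UNIV" by auto
  have "\<forall>U\<in>\<V>. \<exists>V. compact V \<and> U \<subseteq> V"
    using \<V>(1) by (auto simp: \<U>_def)
  then obtain c where c: "\<And>U. U \<in> \<V> \<Longrightarrow> compact (c U)" "\<And>U. U \<in> \<V> \<Longrightarrow> U \<subseteq> c U"
    by metis
  define U where "U = from_nat_into \<V>"
  have range: "range U = \<V>"
    unfolding U_def using \<V>(2) \<open>\<V> \<noteq> {}\<close> by (rule range_from_nat_into[OF _ , rotated])
  show ?thesis
  proof
    show "compact (\<Union>i\<le>n. c (U i))" for n
      using c range by (intro compact_UN) auto
    show "incseq (\<lambda>n. \<Union>i\<le>n. c (U i))"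
      by (rule incseq_SucI) (auto intro: le_SucI)
    show "(\<Union>n. \<Union>i\<le>n. c (U i)) = UNIV"
    proof (intro equalityI subset_UNIV subsetI)
      fix x :: 'a
      obtain n where "x \<in> U n" using cover range by blast
      then have "x \<in> c (U n)" using c(2) range by blast
      then show "x \<in> (\<Union>n. \<Union>i\<le>n. c (U i))" by blast
    qed
  qed
qed

text \<open>Along a compact exhaustion the functions cut off to the complements decrease pointwise
  to 0. Finiteness of the first integral permits monotone convergence from above.\<close>

lemma nn_integral_tail_le:
  fixes \<mu> :: "'a::{t2_space, second_countable_topology} measure" and f :: "'a \<Rightarrow> real"
  assumes "locally compact (UNIV :: 'a set)" and sets: "sets \<mu> = sets borel"
    and f: "f \<in> borel_measurable \<mu>" and fin: "(\<integral>\<^sup>+ y. ennreal (f y) \<partial>\<mu>) < \<infinity>" and "e > 0"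
  obtains C where "compact C" "(\<integral>\<^sup>+ y. ennreal (f y * indicator (- C) y) \<partial>\<mu>) \<le> ennreal e"
proof -
  obtain C :: "nat \<Rightarrow> 'a set"
    where C: "\<And>n. compact (C n)" "incseq C" "(\<Union>n. C n) = UNIV"
    using locally_compact_exhaustion[OF assms(1)] by blast
  define F where "F n y = ennreal (f y) * indicator (- C n) y" for n y
  have meas: "F n \<in> borel_measurable \<mu>" for n
  proof -
    have "- C n \<in> sets \<mu>"
      unfolding sets using C(1) by (intro borel_open open_Compl compact_imp_closed)
    then show ?thesis unfolding F_def using f by measurable
  qed
  have dec: "decseq F"
    using C(2) unfolding F_def
    by (intro decseq_SucI le_funI mult_left_mono) (auto simp: indicator_def incseq_Suc_iff)
  have "(\<integral>\<^sup>+ y. F 0 y \<partial>\<mu>) \<le> (\<integral>\<^sup>+ y. ennreal (f y) \<partial>\<mu>)"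
    by (intro nn_integral_mono) (auto simp: F_def indicator_def)
  then have "(\<integral>\<^sup>+ y. (INF n. F n y) \<partial>\<mu>) = (INF n. integral\<^sup>N \<mu> (F n))"
    using fin by (intro nn_integral_monotone_convergence_INF_decseq[OF dec meas, of 0]) auto
  moreover have "(INF n. F n y) = 0" for y
  proof -
    obtain n where "y \<in> C n" using C(3) by blast
    then have "F n y = 0" by (simp add: F_def)
    then show ?thesis by (metis INF_lower UNIV_I le_zero_eq)
  qed
  ultimately have "(INF n. integral\<^sup>N \<mu> (F n)) < ennreal e"
    using \<open>e > 0\<close> by simp
  then obtain n where "integral\<^sup>N \<mu> (F n) < ennreal e"
    by (auto simp: INF_less_iff)
  moreover have "ennreal (f y * indicator (- C n) y) = F n y" for y
    by (simp add: F_def indicator_def)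
  ultimately show ?thesis
    using that[OF C(1)[of n]] by simp
qed

lemma left_haar_measure_sets: "left_haar_measure \<mu> \<Longrightarrow> sets \<mu> = sets borel"
  by (simp add: left_haar_measure_def radon_measure_def)

lemma left_haar_measure_compact_finite:
  "left_haar_measure \<mu> \<Longrightarrow> compact C \<Longrightarrow> emeasure \<mu> C < \<infinity>"
  by (simp add: left_haar_measure_def radon_measure_def)

lemma left_haar_measure_translate:
  fixes \<mu> :: "'g::{topological_group_add, t2_space} measure"
  assumes "left_haar_measure \<mu>" "compact C"
  shows "measure \<mu> ((\<lambda>y. a + y) ` C) = measure \<mu> C"
  using assms borel_closed[OF compact_imp_closed[OF assms(2)]]
  by (simp add: left_haar_measure_def measure_def)

text \<open>Left invariance on Borel sets says that the image of \<open>\<mu>\<close> under the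
  translation is \<open>\<mu>\<close> itself, because preimages under translation by
  \<open>a\<close> are images under translation by \<open>- a\<close>.\<close>

lemma nn_integral_left_haar_translate:
  fixes \<mu> :: "'g::{topological_group_add, t2_space} measure" and f :: "'g \<Rightarrow> ennreal"
  assumes \<mu>: "left_haar_measure \<mu>" and f: "f \<in> borel_measurable borel"
  shows "(\<integral>\<^sup>+ y. f (a + y) \<partial>\<mu>) = (\<integral>\<^sup>+ y. f y \<partial>\<mu>)"
proof -
  note sets = left_haar_measure_sets[OF \<mu>]
  have "continuous_on UNIV (\<lambda>y. a + y)" by (intro continuous_intros)
  then have T: "(\<lambda>y. a + y) \<in> measurable \<mu> borel"
    using borel_measurable_continuous_onI measurable_cong_sets[OF sets refl] by blast
  have "distr \<mu> borel (\<lambda>y. a + y) = \<mu>"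
  proof (rule measure_eqI)
    show "sets (distr \<mu> borel (\<lambda>y. a + y)) = sets \<mu>" by (simp add: sets)
    fix A assume "A \<in> sets (distr \<mu> borel (\<lambda>y. a + y))"
    then have A: "A \<in> sets borel" by simp
    have "(\<lambda>y. a + y) -` A = (\<lambda>y. - a + y) ` A"
    proof (intro set_eqI iffI)
      fix x assume "x \<in> (\<lambda>y. a + y) -` A"
      then show "x \<in> (\<lambda>y. - a + y) ` A"
        by (intro image_eqI[of _ _ "a + x"]) (auto simp: add.assoc[symmetric])
    qed (auto simp: add.assoc[symmetric])
    then show "emeasure (distr \<mu> borel (\<lambda>y. a + y)) A = emeasure \<mu> A"
      using T A \<mu> sets_eq_imp_space_eq[OF sets]
      by (simp add: emeasure_distr left_haar_measure_def)
  qed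
  moreover have "integral\<^sup>N (distr \<mu> borel (\<lambda>y. a + y)) f = (\<integral>\<^sup>+ y. f (a + y) \<partial>\<mu>)"
    using f by (intro nn_integral_distr T) simp
  ultimately show ?thesis by simp
qed

lemma image_plus_set_plus:
  fixes A C :: "'g::semigroup_add set"
  shows "(\<lambda>y. a + y) ` A + C = (\<lambda>y. a + y) ` (A + C)"
  unfolding set_plus_def by (force simp: add.assoc)

section \<open>Counting points and Beurling density\<close>

text \<open>The count is compared with the measure of \<open>Q + C\<close>, where \<open>C\<close>
  may depend on \<open>\<tau>\<close> but not on \<open>Q\<close>. For \<open>Q\<close> a left
  translate of \<open>K n\<close>, the Folner property makes the thickening by \<open>C\<close>
  asymptotically negligible.\<close>

lemma upper_Beurling_density_le:
  fixes \<mu> :: "'g::{topological_group_add, t2_space} measure"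
  assumes \<mu>: "left_haar_measure \<mu>" and K: "strong_Folner_sequence \<mu> K" and D: "D \<ge> 0"
    and bound: "\<And>\<tau>. 0 < \<tau> \<Longrightarrow> \<tau> < 1 \<Longrightarrow> \<exists>C. compact C \<and> C \<noteq> {} \<and>
      (\<forall>Q. compact Q \<longrightarrow> finite (\<Gamma> \<inter> Q) \<and>
        (1 - \<tau>) * real (card (\<Gamma> \<inter> Q)) \<le> D * measure \<mu> (Q + C))"
  shows "upper_Beurling_density \<mu> K \<Gamma> \<le> ennreal D"
proof (rule ennreal_le_epsilon)
  fix e :: real assume e: "0 < e"
  \<comment> \<open>Chosen so that \<open>D / (1 - \<tau>)\<close> is at most \<open>D + e\<close>;
    the denominator is positive even for \<open>D = 0\<close>.\<close>
  define \<tau> where "\<tau> = e / (2 * (D + e))"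
  have \<tau>: "0 < \<tau>" "\<tau> < 1"
    using e D by (simp_all add: \<tau>_def)
  define B where "B = D / (1 - \<tau>)"
  have "(D + e) * \<tau> = e / 2"
    using e D by (simp add: \<tau>_def field_simps)
  then have "D \<le> (D + e) * (1 - \<tau>)"
    using e by (simp add: right_diff_distrib)
  then have B: "B \<le> D + e" "B \<ge> 0"
    using \<tau> D by (simp_all add: B_def pos_divide_le_eq)
  obtain C where C: "compact C" "C \<noteq> {}"
    and card: "\<And>Q. compact Q \<Longrightarrow> finite (\<Gamma> \<inter> Q)"
      "\<And>Q. compact Q \<Longrightarrow> (1 - \<tau>) * real (card (\<Gamma> \<inter> Q)) \<le> D * measure \<mu> (Q + C)"
    using bound[OF \<tau>] by metis
  have Kn: "compact (K n)" "measure \<mu> (K n) > 0" for n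
    using K by (auto simp: strong_Folner_sequence_def)
  define r where "r n = measure \<mu> (sym_diff (K n) (K n + C)) / measure \<mu> (K n)" for n
  have r: "r \<longlonglongrightarrow> 0"
    using K C unfolding strong_Folner_sequence_def r_def[abs_def] by blast
  have fm: "A \<in> fmeasurable \<mu>" if "compact A" for A
    using left_haar_measure_compact_finite[OF \<mu> that] left_haar_measure_sets[OF \<mu>] that
    by (intro fmeasurableI) (auto intro: borel_closed compact_imp_closed)
  have le: "(SUP x. emeasure (count_space UNIV) (\<Gamma> \<inter> (\<lambda>y. x + y) ` K n) / emeasure \<mu> (K n))
      \<le> ennreal (B * (1 + r n))" for n
  proof (rule SUP_least)
    fix x
    let ?Q = "(\<lambda>y. x + y) ` K n"
    have KC: "compact (K n + C)" by (intro compact_set_plus Kn C)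
    have "compact ?Q" by (intro compact_continuous_image continuous_intros Kn)
    note cQ = card[OF this]
    \<comment> \<open>Left invariance removes \<open>x\<close>, so the resulting bound survives the
      supremum over all translates.\<close>
    have "measure \<mu> (?Q + C) = measure \<mu> (K n + C)"
      unfolding image_plus_set_plus by (rule left_haar_measure_translate[OF \<mu> KC])
    also have "\<dots> \<le> measure \<mu> (K n \<union> sym_diff (K n) (K n + C))"
      by (intro measure_mono_fmeasurable fmeasurableD fmeasurable.Un fmeasurable.Diff fm Kn KC) auto
    also have "\<dots> \<le> measure \<mu> (K n) + measure \<mu> (sym_diff (K n) (K n + C))"
      by (intro measure_Un_le fmeasurableD fmeasurable.Un fmeasurable.Diff fm Kn KC)
    also have "\<dots> = measure \<mu> (K n) * (1 + r n)"
      using Kn(2)[of n] by (simp add: r_def distrib_left)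
    finally have "(1 - \<tau>) * real (card (\<Gamma> \<inter> ?Q)) \<le> D * (measure \<mu> (K n) * (1 + r n))"
      using cQ(2) D by (meson mult_left_mono order_trans)
    then have "real (card (\<Gamma> \<inter> ?Q)) / measure \<mu> (K n) \<le> B * (1 + r n)"
      using \<tau> Kn(2)[of n] by (simp add: B_def field_simps)
    moreover have "emeasure (count_space UNIV) (\<Gamma> \<inter> ?Q) / emeasure \<mu> (K n) =
        ennreal (real (card (\<Gamma> \<inter> ?Q)) / measure \<mu> (K n))"
      using cQ(1) Kn(2)[of n] fm[OF Kn(1)[of n]]
      by (simp add: emeasure_count_space_finite emeasure_eq_measure2 divide_ennreal
          ennreal_of_nat_eq_real_of_nat)
    ultimately show "emeasure (count_space UNIV) (\<Gamma> \<inter> ?Q) / emeasure \<mu> (K n)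
        \<le> ennreal (B * (1 + r n))"
      by (simp add: ennreal_leI)
  qed
  have "(\<lambda>n. B * (1 + r n)) \<longlonglongrightarrow> B * (1 + 0)"
    by (intro tendsto_intros r)
  then have "limsup (\<lambda>n. ennreal (B * (1 + r n))) = ennreal B"
    by (intro lim_imp_Limsup tendsto_ennrealI) simp_all
  then have "upper_Beurling_density \<mu> K \<Gamma> \<le> ennreal B"
    unfolding upper_Beurling_density_def
    by (metis (no_types, lifting) le Limsup_mono always_eventually)
  also have "\<dots> \<le> ennreal D + ennreal e"
    using B D e by (simp add: ennreal_plus[symmetric] ennreal_leI del: ennreal_plus)
  finally show "upper_Beurling_density \<mu> K \<Gamma> \<le> ennreal D + ennreal e" .
qed

text \<open>By the formal degree identity, the orbit \<open>W\<close> of the normalized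
  \<open>\<eta>\<close> is a tight frame with constant \<open>1 / d\<close>. The set
  \<open>C\<close> captures most of the mass of the single coefficient function of \<open>g\<close>;
  translation carries this over to every \<open>\<pi> i g\<close> with \<open>i\<close> in
  \<open>Q\<close>, so one \<open>C\<close> serves all \<open>Q\<close>.\<close>

lemma uniformly_minimal_card_le:
  fixes \<mu> :: "'g::{topological_group_add, t2_space, second_countable_topology} measure"
    and \<pi> :: "'g \<Rightarrow> 'h::chilbert_space \<Rightarrow> 'h"
  assumes lc: "locally compact (UNIV :: 'g set)" and \<mu>: "left_haar_measure \<mu>"
    and \<pi>: "projective_unitary_rep \<pi>" and nz: "(\<eta> :: 'h) \<noteq> 0"
    and deg: "is_formal_degree \<mu> \<pi> d" and \<Lambda>: "locally_finite \<Lambda>"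
    and um: "uniformly_minimal_orbit \<pi> \<Lambda> g" and \<tau>: "\<tau> > 0"
  shows "\<exists>C. compact C \<and> C \<noteq> {} \<and>
    (\<forall>Q. compact Q \<longrightarrow> finite (\<Lambda> \<inter> Q) \<and>
      (1 - \<tau>) * real (card (\<Lambda> \<inter> Q)) \<le> d * measure \<mu> (Q + C))"
proof -
  note sets = left_haar_measure_sets[OF \<mu>]
  obtain \<delta> where \<delta>: "\<delta> > 0"
    and inf: "\<And>\<gamma>. \<gamma> \<in> \<Lambda> \<Longrightarrow> \<delta> \<le> infdist (\<pi> \<gamma> g) (closure (cspan ((\<lambda>\<gamma>'. \<pi> \<gamma>' g) ` (\<Lambda> - {\<gamma>}))))"
    using um unfolding uniformly_minimal_orbit_def by blast
  have U: "unitary (\<pi> x)" and cont: "continuous_on UNIV (\<lambda>x. \<pi> x f)" for x f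
    using \<pi> by (auto simp: projective_unitary_rep_def)
  obtain \<sigma> where \<sigma>: "\<And>x y. cmod (\<sigma> x y) = 1"
    and mult: "\<And>x y f. \<pi> x (\<pi> y f) = scaleC (\<sigma> x y) (\<pi> (x + y) f)"
    using \<pi> unfolding projective_unitary_rep_def by blast
  have d: "d > 0"
    and int: "\<And>f u. (\<integral>\<^sup>+ x. ennreal ((cmod (cinner f (\<pi> x u)))\<^sup>2) \<partial>\<mu>) =
      ennreal (inverse d * (norm f)\<^sup>2 * (norm u)\<^sup>2)"
    using deg by (auto simp: is_formal_degree_def)
  define W where "W y = \<pi> y (scaleR (1 / norm \<eta>) \<eta>)" for y
  have W: "norm (W y) = 1" for y
    using nz by (simp add: W_def unitary_norm[OF U])
  have Wb: "(\<lambda>y. cinner f (W y)) \<in> borel_measurable borel" for f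
    unfolding W_def by (intro borel_measurable_continuous_onI continuous_on_cinner_right cont)
  then have Wm: "(\<lambda>y. cinner f (W y)) \<in> borel_measurable \<mu>" for f
    using measurable_cong_sets[OF sets refl] by blast
  have frame: "(\<integral>\<^sup>+ y. ennreal ((cmod (cinner f (W y)))\<^sup>2) \<partial>\<mu>) = ennreal ((norm f)\<^sup>2 / d)" for f
    unfolding W_def int using nz by (simp add: divide_inverse mult.commute)
  \<comment> \<open>The multiplier has modulus 1, so it disappears from absolute values and the
    coefficients transform as for an ordinary representation.\<close>
  have shift: "cmod (cinner (\<pi> a g) (W (a + y))) = cmod (cinner g (W y))" for a y
  proof -
    have "cinner g (W y) = cinner (\<pi> a g) (\<pi> a (W y))"
      using U[of a] by (simp add: unitary_def)
    also have "\<dots> = cnj (\<sigma> a y) * cinner (\<pi> a g) (W (a + y))"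
      by (simp add: W_def mult cinner_scaleC_right)
    finally show ?thesis by (simp add: norm_mult \<sigma>)
  qed
  have "0 < (\<tau> * \<delta>)\<^sup>2 / d" using \<tau> \<delta> d by simp
  then obtain C' where C': "compact C'" and tail':
    "(\<integral>\<^sup>+ y. ennreal ((cmod (cinner g (W y)))\<^sup>2 * indicator (- C') y) \<partial>\<mu>) \<le> ennreal ((\<tau> * \<delta>)\<^sup>2 / d)"
    using nn_integral_tail_le[OF lc sets, of "\<lambda>y. (cmod (cinner g (W y)))\<^sup>2" "(\<tau> * \<delta>)\<^sup>2 / d"]
      Wm[of g] frame[of g] by auto
  \<comment> \<open>Adding a point secures non-emptiness, since \<open>C'\<close> may be empty;
    enlarging the set only shrinks the tail.\<close>
  define C where "C = insert 0 C'"
  have C: "compact C" "C \<noteq> {}" using C' by (auto simp: C_def)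
  have tail: "(\<integral>\<^sup>+ y. ennreal ((cmod (cinner g (W y)))\<^sup>2 * indicator (- C) y) \<partial>\<mu>)
      \<le> ennreal ((\<tau> * \<delta>)\<^sup>2 / d)"
    by (rule order_trans[OF nn_integral_mono tail'])
      (auto simp: C_def indicator_def intro!: ennreal_leI)
  have "finite (\<Lambda> \<inter> Q) \<and> (1 - \<tau>) * real (card (\<Lambda> \<inter> Q)) \<le> d * measure \<mu> (Q + C)"
    if Q: "compact Q" for Q
  proof
    have "discrete (\<Lambda> \<inter> Q)" "compact (\<Lambda> \<inter> Q)"
      using \<Lambda> Q by (auto simp: locally_finite_def intro: closed_Int_compact)
    then show fin: "finite (\<Lambda> \<inter> Q)"
      using discrete_compact_finite_iff by blast
    have QC: "compact (Q + C)" by (intro compact_set_plus Q C)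
    have QCs: "Q + C \<in> sets borel" using QC by (intro borel_closed compact_imp_closed)
    show "(1 - \<tau>) * real (card (\<Lambda> \<inter> Q)) \<le> d * measure \<mu> (Q + C)"
    proof (rule card_le_measure_of_frame[where v = "\<lambda>i. \<pi> i g", OF Wm d frame _ _ _ fin \<delta> _ \<tau>])
      show "norm (W y) \<le> 1" for y by (simp add: W)
      show "Q + C \<in> sets \<mu>" by (simp add: sets QCs)
      show "emeasure \<mu> (Q + C) < \<infinity>" by (rule left_haar_measure_compact_finite[OF \<mu> QC])
      fix i assume i: "i \<in> \<Lambda> \<inter> Q"
      show "\<delta> \<le> norm (\<pi> i g - p)" if "p \<in> cspan ((\<lambda>i. \<pi> i g) ` (\<Lambda> \<inter> Q - {i}))" for p
      proof -
        have "p \<in> cspan ((\<lambda>i. \<pi> i g) ` (\<Lambda> - {i}))"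
          using that complex_vector.span_mono[of "(\<lambda>i. \<pi> i g) ` (\<Lambda> \<inter> Q - {i})"
              "(\<lambda>i. \<pi> i g) ` (\<Lambda> - {i})"] by blast
        then have "p \<in> closure (cspan ((\<lambda>i. \<pi> i g) ` (\<Lambda> - {i})))"
          using closure_subset by blast
        then show ?thesis
          using inf[of i] i infdist_le[of p _ "\<pi> i g"] by (fastforce simp: dist_norm)
      qed
      let ?f = "\<lambda>y. ennreal ((cmod (cinner (\<pi> i g) (W y)))\<^sup>2 * indicator (- (Q + C)) y)"
      have "?f \<in> borel_measurable borel"
        using QCs Wb by measurable
      \<comment> \<open>After this substitution the integrand involves only the coefficient of
        \<open>g\<close>, and \<open>i + y\<close> outside \<open>Q + C\<close> forces
        \<open>y\<close> outside \<open>C\<close>, because \<open>i\<close> lies in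
        \<open>Q\<close>.\<close>
      then have "(\<integral>\<^sup>+ y. ?f y \<partial>\<mu>) = (\<integral>\<^sup>+ y. ?f (i + y) \<partial>\<mu>)"
        by (rule nn_integral_left_haar_translate[OF \<mu>, symmetric])
      also have "\<dots> \<le> (\<integral>\<^sup>+ y. ennreal ((cmod (cinner g (W y)))\<^sup>2 * indicator (- C) y) \<partial>\<mu>)"
        using i unfolding shift
        by (intro nn_integral_mono ennreal_leI mult_left_mono)
          (auto simp: indicator_def set_plus_intro)
      also note tail
      finally show "(\<integral>\<^sup>+ y. ?f y \<partial>\<mu>) \<le> ennreal ((\<tau> * \<delta>)\<^sup>2 / d)" .
    qed
  qed
  then show ?thesis using C by blast
qed

section \<open>Approximate subgroups: uniform minimality and covering by translates\<close>

text \<open>The unitary \<open>\<pi> (- \<gamma>)\<close> sends \<open>\<pi> \<gamma> g\<close> to a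
  unimodular multiple of \<open>\<pi> 0 g\<close>, and the span over
  \<open>\<Lambda> - {\<gamma>}\<close> into the fixed space \<open>S\<close>. Hence the distance
  from \<open>\<pi> 0 g\<close> to \<open>S\<close> is a lower bound that does not depend on
  \<open>\<gamma>\<close>.\<close>

lemma uniformly_minimal_orbit_of_minimal:
  fixes \<pi> :: "'g::topological_group_add \<Rightarrow> 'h::chilbert_space \<Rightarrow> 'h"
  assumes \<pi>: "projective_unitary_rep \<pi>" and zero: "0 \<in> \<Lambda>" and inv: "uminus ` \<Lambda> = \<Lambda>"
    and min: "minimal_orbit \<pi> (\<Lambda> + \<Lambda>) g"
  shows "uniformly_minimal_orbit \<pi> \<Lambda> g"
proof -
  have U: "unitary (\<pi> x)" for x
    using \<pi> by (auto simp: projective_unitary_rep_def)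
  obtain \<sigma> where \<sigma>: "\<And>x y. cmod (\<sigma> x y) = 1"
    and mult: "\<And>x y f. \<pi> x (\<pi> y f) = scaleC (\<sigma> x y) (\<pi> (x + y) f)"
    using \<pi> unfolding projective_unitary_rep_def by blast
  define S where "S = cspan ((\<lambda>\<gamma>. \<pi> \<gamma> g) ` (\<Lambda> + \<Lambda> - {0}))"
  define \<delta> where "\<delta> = infdist (\<pi> 0 g) (closure S)"
  have "0 + 0 \<in> \<Lambda> + \<Lambda>" using zero by blast
  then have "\<pi> 0 g \<notin> closure S"
    using min by (simp add: minimal_orbit_def S_def)
  moreover have "0 \<in> S" by (simp add: S_def complex_vector.span_zero)
  ultimately have "\<delta> > 0"
    unfolding \<delta>_def by (intro infdist_pos_not_in_closed) (auto simp: closure_eq_empty)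
  have dist: "\<delta> \<le> norm (\<pi> 0 g - s)" if "s \<in> S" for s
    unfolding \<delta>_def dist_norm[symmetric] using that closure_subset by (intro infdist_le) blast
  have "\<delta> \<le> infdist (\<pi> \<gamma> g) (closure (cspan ((\<lambda>\<gamma>'. \<pi> \<gamma>' g) ` (\<Lambda> - {\<gamma>}))))" if \<gamma>: "\<gamma> \<in> \<Lambda>" for \<gamma>
  proof -
    let ?V = "cspan ((\<lambda>\<gamma>'. \<pi> \<gamma>' g) ` (\<Lambda> - {\<gamma>}))"
    \<comment> \<open>Symmetry of \<open>\<Lambda>\<close> puts
      \<open>- \<gamma> + \<gamma>'\<close> into \<open>\<Lambda> + \<Lambda>\<close>, and it is
      non-zero as \<open>\<gamma>'\<close> differs from \<open>\<gamma>\<close>. The multipliers are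
      absorbed by the complex span.\<close>
    have TV: "\<pi> (- \<gamma>) y \<in> S" if "y \<in> ?V" for y
      using that
    proof (induction rule: complex_vector.span_induct_alt)
      case base
      have "\<pi> (- \<gamma>) 0 = 0" using unitary_diff[OF U, of "- \<gamma>" 0 0] by simp
      then show ?case by (simp add: \<open>0 \<in> S\<close>)
    next
      case (step c x y)
      then obtain \<gamma>' where \<gamma>': "\<gamma>' \<in> \<Lambda>" "\<gamma>' \<noteq> \<gamma>" "x = \<pi> \<gamma>' g" by blast
      have "- \<gamma> \<in> \<Lambda>" using \<gamma> inv by blast
      moreover have "- \<gamma> + \<gamma>' \<noteq> 0"
        using \<gamma>'(2) by (metis add.inverse_unique minus_minus)
      ultimately have "\<pi> (- \<gamma> + \<gamma>') g \<in> S"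
        unfolding S_def using \<gamma>'(1) by (intro complex_vector.span_base) blast
      then have "\<pi> (- \<gamma>) x \<in> S"
        unfolding \<gamma>'(3) mult S_def by (rule complex_vector.span_scale)
      then have "scaleC c (\<pi> (- \<gamma>) x) + \<pi> (- \<gamma>) y \<in> S"
        using step unfolding S_def by (intro complex_vector.span_add complex_vector.span_scale)
      then show ?case using U[of "- \<gamma>"] by (simp add: unitary_def)
    qed
    have "\<delta> \<le> dist (\<pi> \<gamma> g) y" if "y \<in> ?V" for y
    proof -
      \<comment> \<open>The phase relating \<open>\<pi> (- \<gamma>) (\<pi> \<gamma> g)\<close> to
        \<open>\<pi> 0 g\<close>. Here \<open>\<pi> 0\<close> is kept as it stands, since in a
        projective representation it may be a scalar other than the identity.\<close>
      define c where "c = \<sigma> (- \<gamma>) \<gamma>"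
      have c: "cmod c = 1" by (simp add: c_def \<sigma>)
      then have "c \<noteq> 0" by auto
      have "scaleC (inverse c) (\<pi> (- \<gamma>) y) \<in> S"
        using TV[OF that] unfolding S_def by (rule complex_vector.span_scale)
      then have "\<delta> \<le> norm (\<pi> 0 g - scaleC (inverse c) (\<pi> (- \<gamma>) y))"
        by (rule dist)
      also have "\<dots> = norm (scaleC c (\<pi> 0 g - scaleC (inverse c) (\<pi> (- \<gamma>) y)))"
        by (simp add: norm_scaleC c)
      also have "scaleC c (\<pi> 0 g - scaleC (inverse c) (\<pi> (- \<gamma>) y)) = \<pi> (- \<gamma>) (\<pi> \<gamma> g - y)"
        using \<open>c \<noteq> 0\<close>
        by (simp add: complex_vector.scale_right_diff_distrib scaleC_scaleC scaleC_one
            unitary_diff[OF U] mult c_def)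
      finally show ?thesis by (simp add: unitary_norm[OF U] dist_norm)
    qed
    then have "?V \<subseteq> {y. \<delta> \<le> dist (\<pi> \<gamma> g) y}" by blast
    moreover have "closed {y. \<delta> \<le> dist (\<pi> \<gamma> g) y}"
      by (intro closed_Collect_le continuous_intros)
    ultimately have *: "closure ?V \<subseteq> {y. \<delta> \<le> dist (\<pi> \<gamma> g) y}"
      by (rule closure_minimal)
    have "closure ?V \<noteq> {}"
      using complex_vector.span_zero by (auto simp: closure_eq_empty)
    then show ?thesis
      using * by (auto simp: infdist_notempty intro!: cINF_greatest)
  qed
  then show ?thesis
    unfolding uniformly_minimal_orbit_def using \<open>\<delta> > 0\<close> by blast
qed

text \<open>Points of \<open>\<Gamma>\<close> in \<open>Q\<close> lie in translates
  \<open>f + T f\<close>, where \<open>T f\<close> consists of the points of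
  \<open>\<Lambda>\<close> in \<open>- f + Q\<close>. The assumed bound applies to each of these
  sets, with the same right-hand side by left invariance.\<close>

lemma card_le_of_finite_cover:
  fixes \<mu> :: "'g::{topological_group_add, t2_space} measure"
  assumes \<mu>: "left_haar_measure \<mu>" and F: "finite F" "\<Gamma> \<subseteq> F + \<Lambda>"
    and C: "compact C" and Q: "compact Q"
    and bound: "\<And>Q. compact Q \<Longrightarrow> finite (\<Lambda> \<inter> Q)"
      "\<And>Q. compact Q \<Longrightarrow> s * real (card (\<Lambda> \<inter> Q)) \<le> D * measure \<mu> (Q + C)" and s: "s \<ge> 0"
  shows "finite (\<Gamma> \<inter> Q) \<and> s * real (card (\<Gamma> \<inter> Q)) \<le> D * real (card F) * measure \<mu> (Q + C)"
proof -
  define T where "T f = \<Lambda> \<inter> (\<lambda>y. - f + y) ` Q" for f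
  have cQ: "compact ((\<lambda>y. - f + y) ` Q)" for f
    by (intro compact_continuous_image continuous_intros Q)
  have T: "finite (T f)" for f
    unfolding T_def by (intro bound cQ)
  have sub: "\<Gamma> \<inter> Q \<subseteq> (\<Union>f\<in>F. (\<lambda>y. f + y) ` T f)"
  proof
    fix x assume x: "x \<in> \<Gamma> \<inter> Q"
    then obtain f l where fl: "f \<in> F" "l \<in> \<Lambda>" "x = f + l"
      using F(2) by (blast elim: set_plus_elim)
    have "l = - f + x" by (simp add: fl(3) add.assoc[symmetric])
    then have "l \<in> T f" using x fl(2) unfolding T_def by blast
    then show "x \<in> (\<Union>f\<in>F. (\<lambda>y. f + y) ` T f)"
      using fl(1,3) by blast
  qed
  have fin: "finite (\<Union>f\<in>F. (\<lambda>y. f + y) ` T f)"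
    using F(1) T by blast
  have "card (\<Gamma> \<inter> Q) \<le> card (\<Union>f\<in>F. (\<lambda>y. f + y) ` T f)"
    by (rule card_mono[OF fin sub])
  also have "\<dots> \<le> (\<Sum>f\<in>F. card ((\<lambda>y. f + y) ` T f))"
    by (rule card_UN_le[OF F(1)])
  also have "\<dots> \<le> (\<Sum>f\<in>F. card (T f))"
    by (intro sum_mono card_image_le T)
  finally have "s * real (card (\<Gamma> \<inter> Q)) \<le> s * real (\<Sum>f\<in>F. card (T f))"
    using s by (intro mult_left_mono) (simp_all only: of_nat_le_iff)
  also have "\<dots> = (\<Sum>f\<in>F. s * real (card (T f)))"
    by (simp add: sum_distrib_left)
  also have "\<dots> \<le> (\<Sum>f\<in>F. D * measure \<mu> (Q + C))"
  proof (intro sum_mono)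
    fix f
    have "s * real (card (T f)) \<le> D * measure \<mu> ((\<lambda>y. - f + y) ` Q + C)"
      unfolding T_def by (intro bound cQ)
    also have "measure \<mu> ((\<lambda>y. - f + y) ` Q + C) = measure \<mu> (Q + C)"
      unfolding image_plus_set_plus
      by (intro left_haar_measure_translate[OF \<mu>] compact_set_plus Q C)
    finally show "s * real (card (T f)) \<le> D * measure \<mu> (Q + C)" .
  qed
  finally show ?thesis
    using finite_subset[OF sub fin] by (simp add: ac_simps)
qed

theorem theorem1p3:
  fixes \<mu> :: "'g::{topological_group_add, t2_space, second_countable_topology} measure"
    and \<pi> :: "'g \<Rightarrow> 'h::chilbert_space \<Rightarrow> 'h"
    and d :: real
    and K :: "nat \<Rightarrow> 'g set"
    and \<Lambda> :: "'g set"
    and g :: 'h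
  assumes "locally compact (UNIV :: 'g set)"
    and "left_haar_measure \<mu>"
    and "right_invariant \<mu>"
    and "amenable \<mu>"
    and "strong_Folner_sequence \<mu> K"
    and "projective_unitary_rep \<pi>"
    and "irreducible_rep \<pi>"
    and "square_integrable_rep \<mu> \<pi>"
    and "is_formal_degree \<mu> \<pi> d"
    and "locally_finite \<Lambda>"
  shows "(uniformly_minimal_orbit \<pi> \<Lambda> g \<longrightarrow> upper_Beurling_density \<mu> K \<Lambda> \<le> ennreal d) \<and>
    (\<forall>k. uniform_approximate_lattice k \<Lambda> \<and> minimal_orbit \<pi> (\<Lambda> + \<Lambda>) g \<longrightarrow>
       upper_Beurling_density \<mu> K (\<Lambda> + \<Lambda>) \<le> ennreal (d * real k))"
proof (intro conjI impI allI)
  \<comment> \<open>Square-integrability supplies the non-zero vector whose normalized orbit is the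
    frame.\<close>
  obtain \<eta> :: 'h where "\<eta> \<noteq> 0"
    using assms(8) unfolding square_integrable_rep_def by blast
  note card_le = uniformly_minimal_card_le[OF assms(1,2,6) this assms(9,10)]
  have d: "d > 0" using assms(9) by (simp add: is_formal_degree_def)
  show "upper_Beurling_density \<mu> K \<Lambda> \<le> ennreal d" if um: "uniformly_minimal_orbit \<pi> \<Lambda> g"
    using d by (intro upper_Beurling_density_le[OF assms(2,5)] card_le[OF um]) auto
  fix k assume asm: "uniform_approximate_lattice k \<Lambda> \<and> minimal_orbit \<pi> (\<Lambda> + \<Lambda>) g"
  then have "approximate_subgroup k \<Lambda>" by (simp add: uniform_approximate_lattice_def)
  then obtain F where F: "finite F" "card F \<le> k" "\<Lambda> + \<Lambda> \<subseteq> F + \<Lambda>"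
    and zero: "0 \<in> \<Lambda>" and inv: "uminus ` \<Lambda> = \<Lambda>"
    unfolding approximate_subgroup_def by blast
  have um: "uniformly_minimal_orbit \<pi> \<Lambda> g"
    using asm by (intro uniformly_minimal_orbit_of_minimal[OF assms(6) zero inv]) simp
  show "upper_Beurling_density \<mu> K (\<Lambda> + \<Lambda>) \<le> ennreal (d * real k)"
  proof (rule upper_Beurling_density_le[OF assms(2,5)])
    show "0 \<le> d * real k" using d by simp
    fix \<tau> :: real assume \<tau>: "0 < \<tau>" "\<tau> < 1"
    obtain C where C: "compact C" "C \<noteq> {}"
      and bound: "\<And>Q. compact Q \<Longrightarrow> finite (\<Lambda> \<inter> Q)"
        "\<And>Q. compact Q \<Longrightarrow> (1 - \<tau>) * real (card (\<Lambda> \<inter> Q)) \<le> d * measure \<mu> (Q + C)"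
      using card_le[OF um \<tau>(1)] by metis
    have "finite ((\<Lambda> + \<Lambda>) \<inter> Q) \<and>
        (1 - \<tau>) * real (card ((\<Lambda> + \<Lambda>) \<inter> Q)) \<le> d * real k * measure \<mu> (Q + C)"
      if Q: "compact Q" for Q
    proof -
      \<comment> \<open>The covering argument loses the factor \<open>card F\<close>, and the
        approximate subgroup property bounds it by \<open>k\<close>.\<close>
      have "d * real (card F) * measure \<mu> (Q + C) \<le> d * real k * measure \<mu> (Q + C)"
        using d F(2) by (intro mult_right_mono mult_left_mono) auto
      moreover have "finite ((\<Lambda> + \<Lambda>) \<inter> Q) \<and> (1 - \<tau>) * real (card ((\<Lambda> + \<Lambda>) \<inter> Q))
          \<le> d * real (card F) * measure \<mu> (Q + C)"
        using \<tau> by (intro card_le_of_finite_cover[OF assms(2) F(1,3) C(1) Q] bound) simp_all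
      ultimately show ?thesis by linarith
    qed
    then show "\<exists>C. compact C \<and> C \<noteq> {} \<and> (\<forall>Q. compact Q \<longrightarrow> finite ((\<Lambda> + \<Lambda>) \<inter> Q) \<and>
        (1 - \<tau>) * real (card ((\<Lambda> + \<Lambda>) \<inter> Q)) \<le> d * real k * measure \<mu> (Q + C))"
      using C by blast
  qed
qed

end
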